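(* Every treelike bigraph is gapless.
   Context: A bigraph $H=([n],[m],E)$ has left part $[n]$, right part $[m]$, edges $E\subseteq[n]\times[m]$, neighborhoods $\mathcal N_H(\cdot)$; its base graph $G_H$ is the graph on $[n]$ where distinct $u,v$ are adjacent iff they share a neighbor in $H$. $H$ is treelike if $G_H$ is a tree. Equip $[0,1]^m$ with Lebesgue measure $\mu$. A family $\mathcal A=\{A_1,\dots,A_n\}$ of measurable subsets of $[0,1]^m$ conforms with $H$ ($\mathcal A\sim H$) if each $A_i=B_i\times[0,1]^{[m]\setminus\mathcal N_H(i)}$ with $B_i\subseteq[0,1]^{\mathcal N_H(i)}$ measurable. The interior $\mathcal I(H)$ is the set of $\vec p\in(0,1)^n$ such that $\mu(\bigcap_i([0,1]^m\setminus A_i))>0$ for every $\mathcal A\sim H$ with $\mu(A_i)=p_i$ for all $i$. For a graph $G$ on $[n]$, the abstract interior $\mathcal I_a(G)$ is the set of $\vec p\in(0,1)^n$ such that for every probability space and events $A_1,\dots,A_n$ with $\Pr(A_i)=p_i$ for which $G$ is a dependency graph (each $A_i$ mutually independent of $\{A_j:j\ne i, j\notin\mathcal N_G(i)\}$), $\Pr(\bigcap_i\overline{A_i})>0$. $H$ is gapful in the direction of $\vec p\in(0,1)^n$ if there is $\lambda>0$ with $\lambda\vec p\in\mathcal I(H)\setminus\mathcal I_a(G_H)$; $H$ is gapful if it is gapful in some direction, and gapless otherwise. *)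

theory Defs
  imports "HOL-Probability.Probability"
begin

text \<open>
  Bigraphs are given by \<open>n\<close>, \<open>m\<close> and an edge set \<open>E\<close>; the vertex sets \<open>[n]\<close> and \<open>[m]\<close> are
  \<open>{1..n}\<close> and \<open>{1..m}\<close>.
\<close>

definition bigraph :: "nat \<Rightarrow> nat \<Rightarrow> (nat \<times> nat) set \<Rightarrow> bool" where
  "bigraph n m E \<longleftrightarrow> E \<subseteq> {1..n} \<times> {1..m}"

definition nbrs :: "(nat \<times> nat) set \<Rightarrow> nat \<Rightarrow> nat set" where
  "nbrs E i = {j. (i, j) \<in> E}"

definition base_graph :: "nat \<Rightarrow> (nat \<times> nat) set \<Rightarrow> (nat \<times> nat) set" where
  "base_graph n E =
    {(u, v). u \<in> {1..n} \<and> v \<in> {1..n} \<and> u \<noteq> v \<and> nbrs E u \<inter> nbrs E v \<noteq> {}}"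

text \<open>
  Simple undirected graphs on \<open>V\<close> are represented by symmetric irreflexive adjacency relations.
  Cycles must have length at least three: going back and forth along one edge is not a cycle.
\<close>

definition is_cycle :: "(nat \<times> nat) set \<Rightarrow> nat list \<Rightarrow> bool" where
  "is_cycle G xs \<longleftrightarrow>
    3 \<le> length xs \<and> distinct xs \<and> successively (\<lambda>u v. (u, v) \<in> G) xs \<and> (last xs, hd xs) \<in> G"

definition is_tree :: "nat set \<Rightarrow> (nat \<times> nat) set \<Rightarrow> bool" where
  "is_tree V G \<longleftrightarrow> V \<noteq> {} \<and> (\<forall>u\<in>V. \<forall>v\<in>V. (u, v) \<in> G\<^sup>*) \<and> (\<nexists>xs. is_cycle G xs)"

definition treelike :: "nat \<Rightarrow> (nat \<times> nat) set \<Rightarrow> bool" where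
  "treelike n E \<longleftrightarrow> is_tree {1..n} (base_graph n E)"

text \<open>
  The completed product measure is Lebesgue measure on \<open>[0,1]\<^sup>I\<close>, so that measurable sets are
  the Lebesgue measurable ones. Points are functions extended by \<^const>\<open>undefined\<close> outside \<open>I\<close>.
\<close>

definition unit_interval :: "real measure" where
  "unit_interval = restrict_space lborel {0..1}"

definition unit_cube :: "nat set \<Rightarrow> (nat \<Rightarrow> real) measure" where
  "unit_cube I = completion (PiM I (\<lambda>_. unit_interval))"

lemma prob_space_unit_cube: "prob_space (unit_cube I)"
proof -
  have "prob_space unit_interval"
    unfolding unit_interval_def by (rule prob_spaceI) (simp add: emeasure_restrict_space)
  then have "prob_space (PiM I (\<lambda>_. unit_interval))"
    by (intro prob_space_PiM)
  then show ?thesis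
    unfolding unit_cube_def by (rule prob_space.prob_space_completion)
qed

text \<open>\<^const>\<open>prod_emb\<close> turns \<open>B\<close> into the cylinder \<open>B \<times> [0,1]\<^bsup>[m] - N(i)\<^esup>\<close>.\<close>

definition conforms :: "nat \<Rightarrow> nat \<Rightarrow> (nat \<times> nat) set \<Rightarrow> (nat \<Rightarrow> (nat \<Rightarrow> real) set) \<Rightarrow> bool" where
  "conforms n m E A \<longleftrightarrow>
    (\<forall>i\<in>{1..n}. \<exists>B\<in>sets (unit_cube (nbrs E i)).
      A i = prod_emb {1..m} (\<lambda>_. unit_interval) (nbrs E i) B)"

text \<open>
  Vectors in \<open>(0,1)\<^sup>n\<close> are extensional functions on \<open>{1..n}\<close>.
\<close>

definition bigraph_interior :: "nat \<Rightarrow> nat \<Rightarrow> (nat \<times> nat) set \<Rightarrow> (nat \<Rightarrow> real) set" where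
  "bigraph_interior n m E =
    {p \<in> {1..n} \<rightarrow>\<^sub>E {0<..<1}.
      \<forall>A. conforms n m E A \<and> (\<forall>i\<in>{1..n}. measure (unit_cube {1..m}) (A i) = p i) \<longrightarrow>
        measure (unit_cube {1..m}) {x \<in> space (unit_cube {1..m}). \<forall>i\<in>{1..n}. x \<notin> A i} > 0}"

text \<open>
  Mutual independence of \<open>A i\<close> from a family of events means independence from the
  sigma-algebra generated by that family.
\<close>

definition dependency_graph ::
    "'w measure \<Rightarrow> nat \<Rightarrow> (nat \<times> nat) set \<Rightarrow> (nat \<Rightarrow> 'w set) \<Rightarrow> bool" where
  "dependency_graph M n G A \<longleftrightarrow>
    (\<forall>i\<in>{1..n}. prob_space.indep_set M {A i}
      (sigma_sets (space M) (A ` {j \<in> {1..n}. j \<noteq> i \<and> (i, j) \<notin> G})))"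

text \<open>
  A definition cannot quantify over all types of sample spaces, so the type \<open>'w\<close> of elementary
  events is a parameter here and in the notions below. Statements quantify over it by leaving
  \<open>'w\<close> free: the abstract interior is the intersection over all \<open>'w\<close>, hence a bigraph is gapless
  iff it is gapless for each \<open>'w\<close>.
\<close>

definition abstract_interior ::
    "'w itself \<Rightarrow> nat \<Rightarrow> (nat \<times> nat) set \<Rightarrow> (nat \<Rightarrow> real) set" where
  "abstract_interior W n G =
    {p \<in> {1..n} \<rightarrow>\<^sub>E {0<..<1}.
      \<forall>(M :: 'w measure) A.
        prob_space M \<and> (\<forall>i\<in>{1..n}. A i \<in> sets M \<and> measure M (A i) = p i) \<and>
        dependency_graph M n G A \<longrightarrow>
          measure M {x \<in> space M. \<forall>i\<in>{1..n}. x \<notin> A i} > 0}"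

definition gapful_in_direction ::
    "'w itself \<Rightarrow> nat \<Rightarrow> nat \<Rightarrow> (nat \<times> nat) set \<Rightarrow> (nat \<Rightarrow> real) \<Rightarrow> bool" where
  "gapful_in_direction W n m E p \<longleftrightarrow>
    (\<exists>c::real. c > 0 \<and>
      (\<lambda>i\<in>{1..n}. c * p i) \<in> bigraph_interior n m E - abstract_interior W n (base_graph n E))"

definition gapful :: "'w itself \<Rightarrow> nat \<Rightarrow> nat \<Rightarrow> (nat \<times> nat) set \<Rightarrow> bool" where
  "gapful W n m E \<longleftrightarrow> (\<exists>p \<in> {1..n} \<rightarrow>\<^sub>E {0<..<1}. gapful_in_direction W n m E p)"

definition gapless :: "'w itself \<Rightarrow> nat \<Rightarrow> nat \<Rightarrow> (nat \<times> nat) set \<Rightarrow> bool" where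
  "gapless W n m E \<longleftrightarrow> \<not> gapful W n m E"

end

theory Submission
  imports Defs
begin

text \<open>
  The proof eliminates leaves of the tree. A leaf \<open>u\<close> with neighbor \<open>w\<close> is removed while
  \<open>p w\<close> becomes \<open>p w / (1 - p u)\<close>, the largest conditional probability of the event at \<open>w\<close> given
  that the one at \<open>u\<close> fails. If all probabilities stay below \<open>1\<close>, then in every probability space
  the events are avoided with positive probability. If some probability reaches \<open>1\<close>, undoing the
  eliminations gives a cover of the cube by axis-parallel boxes: a variable shared by \<open>u\<close> and \<open>w\<close>
  is cut at \<open>p u\<close>, with \<open>u\<close> taking the lower part and \<open>w\<close> the upper part.
\<close>

section \<open>Leaves of acyclic graphs\<close>

text \<open>Take an end of a longest path inside \<open>S\<close>: a neighbor in \<open>S\<close>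
  off the path would extend it, and one beyond the second vertex would close a cycle. The vertex
  found may also be isolated in \<open>S\<close>.\<close>

lemma acyclic_graph_leaf:
  assumes "finite S" "S \<noteq> {}" "sym G" "irrefl G" and acyclic: "\<nexists>xs. is_cycle G xs"
  obtains u where "u \<in> S"
    and "\<And>v w. v \<in> S \<Longrightarrow> w \<in> S \<Longrightarrow> (u, v) \<in> G \<Longrightarrow> (u, w) \<in> G \<Longrightarrow> v = w"
proof -
  let ?path = "\<lambda>xs. xs \<noteq> [] \<and> set xs \<subseteq> S \<and> distinct xs \<and> successively (\<lambda>u v. (u, v) \<in> G) xs"
  obtain s where "s \<in> S" using assms by blast
  then have "?path [s]" by simp
  moreover have "length xs < Suc (card S)" if "?path xs" for xs
    using that assms(1) by (metis card_mono distinct_card le_imp_less_Suc)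
  ultimately obtain xs where xs: "?path xs" and longest: "\<And>ys. ?path ys \<Longrightarrow> length ys \<le> length xs"
    using ex_has_greatest_nat[of ?path "[s]" length "Suc (card S)"] by (metis less_imp_le_nat)
  have inside: "v \<in> set xs" if "v \<in> S" "(hd xs, v) \<in> G" for v
  proof (rule ccontr)
    assume "v \<notin> set xs"
    moreover have "(v, hd xs) \<in> G" using that(2) \<open>sym G\<close> by (rule symD[rotated])
    ultimately have "?path (v # xs)" using xs that(1) by (cases xs) auto
    then show False using longest by fastforce
  qed
  have index: "k = 1" if "k < length xs" "(hd xs, xs ! k) \<in> G" for k
  proof (rule ccontr)
    assume "k \<noteq> 1"
    have "k \<noteq> 0"
    proof
      assume "k = 0"
      then have "(hd xs, hd xs) \<in> G" using that xs by (simp add: hd_conv_nth)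
      then show False using \<open>irrefl G\<close> by (simp add: irrefl_def)
    qed
    \<comment> \<open>The prefix ending at the neighbor is the cycle; \<open>k\<close> at least 2
      gives it length at least 3.\<close>
    let ?c = "take (Suc k) xs"
    have "last ?c = xs ! k" using that by (simp add: take_Suc_conv_app_nth)
    moreover have "hd ?c = hd xs" using xs by simp
    moreover have "successively (\<lambda>u v. (u, v) \<in> G) ?c"
      using xs by (metis append_take_drop_id successively_append_iff)
    ultimately have "is_cycle G ?c"
      using that xs \<open>k \<noteq> 0\<close> \<open>k \<noteq> 1\<close> \<open>sym G\<close> by (auto simp: is_cycle_def dest: symD)
    then show False using acyclic by blast
  qed
  show thesis
  proof (rule that[of "hd xs"])
    show "hd xs \<in> S" using xs by auto
    fix v w assume *: "v \<in> S" "w \<in> S" "(hd xs, v) \<in> G" "(hd xs, w) \<in> G"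
    then obtain k l where "k < length xs" "v = xs ! k" "l < length xs" "w = xs ! l"
      using inside by (metis in_set_conv_nth)
    then show "v = w" using index[of k] index[of l] * by simp
  qed
qed

lemma sym_base_graph: "sym (base_graph n E)"
  by (auto simp: sym_def base_graph_def)

lemma irrefl_base_graph: "irrefl (base_graph n E)"
  by (auto simp: irrefl_def base_graph_def)

section \<open>Elimination of leaves\<close>

text \<open>
  \<open>F T\<close> plays the role of the probability that no event with index in \<open>T\<close> occurs. The last clause
  is supermodularity; the middle one is a one-sided form of independence, which, unlike
  independence itself, survives conditioning on the failure of a leaf event.
\<close>

definition avoidance :: "(nat \<times> nat) set \<Rightarrow> nat set \<Rightarrow> (nat \<Rightarrow> real) \<Rightarrow> (nat set \<Rightarrow> real) \<Rightarrow> bool" where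
  "avoidance G S p F \<longleftrightarrow>
    F {} > 0 \<and>
    (\<forall>i\<in>S. \<forall>T\<subseteq>S. i \<notin> T \<longrightarrow> (\<forall>k\<in>T. (i, k) \<notin> G) \<longrightarrow> (1 - p i) * F T \<le> F (insert i T)) \<and>
    (\<forall>i\<in>S. \<forall>k\<in>S. \<forall>T\<subseteq>S. F (insert i T) - F (insert k (insert i T)) \<le> F T - F (insert k T))"

lemma avoidance_empty: "avoidance G S p F \<Longrightarrow> F {} > 0"
  by (simp add: avoidance_def)

lemma avoidance_insert:
  assumes "avoidance G S p F" "i \<in> S" "T \<subseteq> S" "i \<notin> T" "\<And>k. k \<in> T \<Longrightarrow> (i, k) \<notin> G"
  shows "(1 - p i) * F T \<le> F (insert i T)"
  using assms by (simp add: avoidance_def)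

lemma avoidance_supermodular:
  assumes "avoidance G S p F" "i \<in> S" "k \<in> S" "T \<subseteq> S"
  shows "F (insert i T) - F (insert k (insert i T)) \<le> F T - F (insert k T)"
  using assms by (simp add: avoidance_def)

lemma avoidance_singleton_pos:
  assumes "avoidance G S p F" "u \<in> S" "p u < 1"
  shows "F {u} > 0"
proof -
  have "0 < (1 - p u) * F {}" using assms avoidance_empty by simp
  also have "\<dots> \<le> F {u}" using assms by (intro avoidance_insert) auto
  finally show ?thesis .
qed

text \<open>\<open>F (insert u T)\<close> is conditioning on the failure of \<open>u\<close> without
  normalization; this is harmless because the inequalities are homogeneous in \<open>F\<close> and
  \<open>F {u}\<close> is positive.\<close>

lemma avoidance_isolated:
  assumes "avoidance G S p F" "u \<in> S" "p u < 1" "sym G"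
    and isolated: "\<And>k. k \<in> S \<Longrightarrow> (u, k) \<notin> G"
  shows "avoidance G (S - {u}) p (\<lambda>T. F (insert u T))"
  unfolding avoidance_def
proof (intro conjI ballI allI impI)
  show "F {u} > 0" using assms avoidance_singleton_pos by blast
next
  fix i T assume *: "i \<in> S - {u}" "T \<subseteq> S - {u}" "i \<notin> T" "\<forall>k\<in>T. (i, k) \<notin> G"
  then have "(i, u) \<notin> G" using isolated \<open>sym G\<close> by (auto dest: symD)
  with * have "(1 - p i) * F (insert u T) \<le> F (insert i (insert u T))"
    using assms(2) by (intro avoidance_insert[OF assms(1)]) auto
  then show "(1 - p i) * F (insert u T) \<le> F (insert u (insert i T))"
    by (simp add: insert_commute)
next
  fix i k T assume *: "i \<in> S - {u}" "k \<in> S - {u}" "T \<subseteq> S - {u}"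
  then have "insert u T \<subseteq> S" using assms(2) by blast
  then have "F (insert i (insert u T)) - F (insert k (insert i (insert u T)))
      \<le> F (insert u T) - F (insert k (insert u T))"
    using * by (intro avoidance_supermodular[OF assms(1)]) auto
  then show "F (insert u (insert i T)) - F (insert u (insert k (insert i T)))
      \<le> F (insert u T) - F (insert u (insert k T))"
    by (simp add: insert_commute)
qed

text \<open>Only the bound at \<open>w\<close> is affected. By supermodularity, adding
  \<open>w\<close> costs at most as much after \<open>u\<close> as before, so at most
  \<open>p w * F T\<close>; and \<open>F T\<close> is at most
  \<open>F (insert u T) / (1 - p u)\<close>.\<close>

lemma avoidance_leaf:
  assumes F: "avoidance G S p F" and "u \<in> S" "w \<in> S" "u \<noteq> w" "p u < 1" "0 \<le> p w" "sym G"
    and leaf: "\<And>k. k \<in> S \<Longrightarrow> (u, k) \<in> G \<Longrightarrow> k = w"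
  shows "avoidance G (S - {u}) (p(w := p w / (1 - p u))) (\<lambda>T. F (insert u T))"
  unfolding avoidance_def
proof (intro conjI ballI allI impI)
  show "F {u} > 0" using assms avoidance_singleton_pos by blast
next
  fix i T assume *: "i \<in> S - {u}" "T \<subseteq> S - {u}" "i \<notin> T" "\<forall>k\<in>T. (i, k) \<notin> G"
  show "(1 - (p(w := p w / (1 - p u))) i) * F (insert u T) \<le> F (insert u (insert i T))"
  proof (cases "i = w")
    case False
    then have "(i, u) \<notin> G" using leaf * \<open>sym G\<close> by (auto dest: symD)
    with * have "(1 - p i) * F (insert u T) \<le> F (insert i (insert u T))"
      using assms(2) False by (intro avoidance_insert[OF assms(1)]) auto
    then show ?thesis using False by (simp add: insert_commute)
  next
    case True
    \<comment> \<open>Since \<open>T\<close> omits \<open>w\<close>, the only possible neighbor of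
      \<open>u\<close> in \<open>S\<close>, the one-sided independence also applies to
      \<open>u\<close> and \<open>T\<close>.\<close>
    have "(u, k) \<notin> G" if "k \<in> T" for k using leaf[of k] * that True by auto
    then have u: "(1 - p u) * F T \<le> F (insert u T)"
      using \<open>u \<in> S\<close> * by (intro avoidance_insert[OF F]) auto
    have w: "(1 - p w) * F T \<le> F (insert w T)"
      using True \<open>w \<in> S\<close> * by (intro avoidance_insert[OF F]) auto
    have "F (insert u T) - F (insert w (insert u T)) \<le> F T - F (insert w T)"
      using \<open>u \<in> S\<close> \<open>w \<in> S\<close> * by (intro avoidance_supermodular[OF F]) auto
    also have "\<dots> \<le> p w * F T" using w by (simp add: algebra_simps)
    also have "\<dots> \<le> p w * (F (insert u T) / (1 - p u))"
      using u \<open>p u < 1\<close> \<open>0 \<le> p w\<close> by (intro mult_left_mono) (simp_all add: field_simps)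
    finally show ?thesis using True by (simp add: algebra_simps insert_commute)
  qed
next
  fix i k T assume *: "i \<in> S - {u}" "k \<in> S - {u}" "T \<subseteq> S - {u}"
  then have "insert u T \<subseteq> S" using assms(2) by blast
  then have "F (insert i (insert u T)) - F (insert k (insert i (insert u T)))
      \<le> F (insert u T) - F (insert k (insert u T))"
    using * by (intro avoidance_supermodular[OF assms(1)]) auto
  then show "F (insert u (insert i T)) - F (insert u (insert k (insert i T)))
      \<le> F (insert u T) - F (insert u (insert k T))"
    by (simp add: insert_commute)
qed

section \<open>Box covers and undoing an elimination\<close>

text \<open>
  The box of \<open>i\<close> is the product of the intervals from \<open>a i j\<close> to \<open>b i j\<close>. It is constrained only
  in variables that \<open>i\<close> shares within \<open>S\<close>, so a variable shared with a leaf outside \<open>S\<close> is still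
  free. Vertices outside \<open>R\<close> have no box.
\<close>

definition box_cover ::
    "(nat \<times> nat) set \<Rightarrow> nat set \<Rightarrow> (nat \<Rightarrow> real) \<Rightarrow> nat set \<Rightarrow>
      (nat \<Rightarrow> nat \<Rightarrow> real) \<Rightarrow> (nat \<Rightarrow> nat \<Rightarrow> real) \<Rightarrow> bool" where
  "box_cover E S p R a b \<longleftrightarrow>
    R \<subseteq> S \<and>
    (\<forall>i\<in>R. (\<Prod>j\<in>nbrs E i. b i j - a i j) \<le> p i) \<and>
    (\<forall>i\<in>R. \<forall>j. 0 \<le> a i j \<and> a i j \<le> b i j \<and> b i j \<le> 1) \<and>
    (\<forall>i\<in>R. \<forall>j. (\<forall>k\<in>S - {i}. j \<notin> nbrs E k) \<longrightarrow> a i j = 0 \<and> b i j = 1) \<and>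
    (\<forall>x. (\<forall>j. 0 \<le> x j \<and> x j \<le> 1) \<longrightarrow> (\<exists>i\<in>R. \<forall>j\<in>nbrs E i. a i j \<le> x j \<and> x j \<le> b i j))"

lemma box_cover_whole:
  assumes "i \<in> S" "p i \<ge> 1"
  shows "box_cover E S p {i} (\<lambda>_ _. 0) (\<lambda>_ _. 1)"
  using assms by (auto simp: box_cover_def)

text \<open>A larger vertex set leaves fewer variables unshared, so the clause demanding full sides
  becomes weaker.\<close>

lemma box_cover_mono:
  assumes "box_cover E S p R a b" "S \<subseteq> S'" "\<And>i. i \<in> R \<Longrightarrow> p i \<le> p' i"
  shows "box_cover E S' p' R a b"
proof -
  have "(\<Prod>j\<in>nbrs E i. b i j - a i j) \<le> p' i" if "i \<in> R" for i
    using assms that unfolding box_cover_def by (meson order_trans)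
  then show ?thesis using assms unfolding box_cover_def by blast
qed

text \<open>Among the vertices of \<open>S - {u}\<close> only \<open>w\<close> can use
  \<open>y\<close>, so the box of \<open>w\<close> has the full side there. Shortening that side to
  length \<open>1 - p u\<close> turns the volume bound \<open>p w / (1 - p u)\<close> into
  \<open>p w\<close>, and the freed part goes to \<open>u\<close>.\<close>

lemma box_cover_leaf:
  assumes B: "box_cover E (S - {u}) (p(w := p w / (1 - p u))) R a b"
    and "finite (nbrs E u)" "finite (nbrs E w)" "u \<in> S" "w \<in> S" "u \<noteq> w"
    and "0 < p u" "p u < 1"
    and y: "y \<in> nbrs E u" "y \<in> nbrs E w"
    and leaf: "\<And>k. k \<in> S - {u, w} \<Longrightarrow> y \<notin> nbrs E k"
  shows "\<exists>R a b. box_cover E S p R a b"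
proof (cases "w \<in> R")
  case False
  then have "box_cover E S p R a b"
    by (intro box_cover_mono[OF B]) auto
  then show ?thesis by blast
next
  case True
  have uR: "u \<notin> R" using B by (auto simp: box_cover_def)
  \<comment> \<open>The box of \<open>u\<close> is cut only at \<open>y\<close>, to the interval
    from 0 to \<open>p u\<close>; the box of \<open>w\<close> now starts at \<open>p u\<close>
    there.\<close>
  define a' where "a' = a(u := (\<lambda>_. 0), w := (a w)(y := p u))"
  define b' where "b' = b(u := (\<lambda>_. 1)(y := p u))"
  have free: "a w y = 0" "b w y = 1"
    using B True leaf by (auto simp: box_cover_def)
  have au: "a' u = (\<lambda>_. 0)" "b' u = (\<lambda>_. 1)(y := p u)"
    and aw: "a' w = (a w)(y := p u)" "b' w = b w"
    and other: "\<And>i. i \<noteq> u \<Longrightarrow> i \<noteq> w \<Longrightarrow> a' i = a i \<and> b' i = b i"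
    using \<open>u \<noteq> w\<close> by (auto simp: a'_def b'_def)
  have prod_u: "(\<Prod>j\<in>nbrs E u. b' u j - a' u j) = p u"
    using y assms(2) by (simp add: au prod.remove[of _ y])
  have "(\<Prod>j\<in>nbrs E w. b w j - a w j) \<le> p w / (1 - p u)"
    using B True by (auto simp: box_cover_def)
  then have "(\<Prod>j\<in>nbrs E w - {y}. b w j - a w j) \<le> p w / (1 - p u)"
    using y assms(3) by (simp add: free prod.remove[of _ y])
  then have prod_w: "(\<Prod>j\<in>nbrs E w. b' w j - a' w j) \<le> p w"
    using y assms(3) free \<open>p u < 1\<close> by (simp add: aw prod.remove[of _ y] field_simps)
  have "box_cover E S p (insert u R) a' b'"
    unfolding box_cover_def
  proof (intro conjI ballI allI impI)
    show "insert u R \<subseteq> S" using B \<open>u \<in> S\<close> by (auto simp: box_cover_def)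
  next
    fix i assume i: "i \<in> insert u R"
    consider "i = u" | "i = w" | "i \<noteq> u" "i \<noteq> w" "i \<in> R" using i by blast
    then show "(\<Prod>j\<in>nbrs E i. b' i j - a' i j) \<le> p i"
    proof cases
      case 3
      then have "(\<Prod>j\<in>nbrs E i. b i j - a i j) \<le> (p(w := p w / (1 - p u))) i"
        using B unfolding box_cover_def by blast
      then show ?thesis using 3 other by simp
    qed (use prod_u prod_w in auto)
  next
    fix i j assume i: "i \<in> insert u R"
    have old: "0 \<le> a i j \<and> a i j \<le> b i j \<and> b i j \<le> 1" if "i \<in> R"
      using B that unfolding box_cover_def by blast
    have "0 \<le> a' i j \<and> a' i j \<le> b' i j \<and> b' i j \<le> 1"
      using i old free au aw other[of i] \<open>0 < p u\<close> \<open>p u < 1\<close> True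
      by (cases "i = u"; cases "i = w") auto
    then show "0 \<le> a' i j" "a' i j \<le> b' i j" "b' i j \<le> 1" by auto
  next
    fix i j assume i: "i \<in> insert u R" and unshared: "\<forall>k\<in>S - {i}. j \<notin> nbrs E k"
    have old: "a i j = 0 \<and> b i j = 1" if "i \<in> R"
      using B that unshared unfolding box_cover_def by blast
    \<comment> \<open>The two altered boxes change only at \<open>y\<close>, which \<open>u\<close>
      and \<open>w\<close> share.\<close>
    have "j \<noteq> y" if "i = u \<or> i = w"
      using that unshared y \<open>u \<in> S\<close> \<open>w \<in> S\<close> \<open>u \<noteq> w\<close> by blast
    then have "a' i j = 0 \<and> b' i j = 1"
      using i old au aw other[of i] \<open>u \<noteq> w\<close> by (cases "i = u"; cases "i = w") auto
    then show "a' i j = 0" "b' i j = 1" by auto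
  next
    fix x :: "nat \<Rightarrow> real" assume x: "\<forall>j. 0 \<le> x j \<and> x j \<le> 1"
    then obtain i where i: "i \<in> R" "\<forall>j\<in>nbrs E i. a i j \<le> x j \<and> x j \<le> b i j"
      using B unfolding box_cover_def by blast
    show "\<exists>i\<in>insert u R. \<forall>j\<in>nbrs E i. a' i j \<le> x j \<and> x j \<le> b' i j"
    proof (cases "i = w")
      case False
      then have "a' i = a i" "b' i = b i" using i(1) uR other[of i] by auto
      then show ?thesis using i by (intro bexI[of _ i]) auto
    next
      case True
      show ?thesis
      proof (cases "p u \<le> x y")
        case True
        then show ?thesis using i \<open>i = w\<close> aw by (intro bexI[of _ w]) auto
      next
        case False
        then show ?thesis using x au by (intro bexI[of _ u]) auto
      qed
    qed
  qed
  then show ?thesis by blast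
qed

section \<open>The dichotomy for acyclic base graphs\<close>

text \<open>Induction over \<open>S\<close> removing a leaf or isolated vertex, with
  \<open>p\<close> arbitrary since elimination changes it. No upper bound on \<open>p\<close> is
  assumed, because a reduced value may reach 1; then one full box covers everything.\<close>

lemma box_cover_or_avoidance_pos:
  assumes "bigraph n m E" "\<nexists>xs. is_cycle (base_graph n E) xs"
    and "finite S" "S \<subseteq> {1..n}" "\<And>i. i \<in> S \<Longrightarrow> 0 < p i"
  shows "(\<exists>R a b. box_cover E S p R a b) \<or> (\<forall>F. avoidance (base_graph n E) S p F \<longrightarrow> F S > 0)"
  using assms(3-)
proof (induction S arbitrary: p rule: finite_psubset_induct)
  case (psubset S)
  let ?G = "base_graph n E"
  have fin: "finite (nbrs E i)" for i
    using assms(1) by (intro finite_subset[of "nbrs E i" "{1..m}"]) (auto simp: bigraph_def nbrs_def)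
  consider "S = {}" | i where "i \<in> S" "p i \<ge> 1" | "S \<noteq> {}" "\<And>i. i \<in> S \<Longrightarrow> p i < 1"
    by fastforce
  then show ?case
  proof cases
    case 1
    then show ?thesis by (auto simp: avoidance_def)
  next
    case 2
    then show ?thesis using box_cover_whole by blast
  next
    case 3
    obtain u where u: "u \<in> S"
      and leaf: "\<And>v w. v \<in> S \<Longrightarrow> w \<in> S \<Longrightarrow> (u, v) \<in> ?G \<Longrightarrow> (u, w) \<in> ?G \<Longrightarrow> v = w"
      using acyclic_graph_leaf[OF psubset.hyps(1) 3(1) sym_base_graph irrefl_base_graph assms(2)]
      by blast
    have smaller: "S - {u} \<subset> S" using u by blast
    show ?thesis
    proof (cases "\<exists>w\<in>S. (u, w) \<in> ?G")
      case False
      have "(\<exists>R a b. box_cover E (S - {u}) p R a b) \<or>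
          (\<forall>F. avoidance ?G (S - {u}) p F \<longrightarrow> F (S - {u}) > 0)"
        using psubset.prems by (intro psubset.IH[OF smaller]) auto
      then show ?thesis
      proof
        assume "\<exists>R a b. box_cover E (S - {u}) p R a b"
        then show ?thesis using box_cover_mono[where S' = S and p' = p] by blast
      next
        assume pos: "\<forall>F. avoidance ?G (S - {u}) p F \<longrightarrow> F (S - {u}) > 0"
        have "F S > 0" if "avoidance ?G S p F" for F
          using pos[rule_format, OF avoidance_isolated[OF that u 3(2)[OF u] sym_base_graph]]
            False u by (auto simp: insert_absorb)
        then show ?thesis by blast
      qed
    next
      case True
      then obtain w where w: "w \<in> S" "(u, w) \<in> ?G" by blast
      then obtain y where y: "y \<in> nbrs E u" "y \<in> nbrs E w" and "u \<noteq> w"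
        by (auto simp: base_graph_def)
      let ?p = "p(w := p w / (1 - p u))"
      have "(\<exists>R a b. box_cover E (S - {u}) ?p R a b) \<or>
          (\<forall>F. avoidance ?G (S - {u}) ?p F \<longrightarrow> F (S - {u}) > 0)"
        using psubset.prems 3(2)[OF u] w by (intro psubset.IH[OF smaller]) auto
      then show ?thesis
      proof
        assume "\<exists>R a b. box_cover E (S - {u}) ?p R a b"
        then obtain R a b where B: "box_cover E (S - {u}) ?p R a b" by blast
        \<comment> \<open>A third vertex using \<open>y\<close> would be a second neighbor of the
          leaf \<open>u\<close>.\<close>
        have "y \<notin> nbrs E k" if "k \<in> S - {u, w}" for k
        proof
          assume "y \<in> nbrs E k"
          then have "(u, k) \<in> ?G"
            using that y u psubset.prems(1) by (auto simp: base_graph_def)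
          then show False using leaf[of k w] w that by blast
        qed
        then show ?thesis
          using box_cover_leaf[OF B fin fin u w(1) \<open>u \<noteq> w\<close> _ 3(2)[OF u] y] psubset.prems(2)[OF u]
          by blast
      next
        assume pos: "\<forall>F. avoidance ?G (S - {u}) ?p F \<longrightarrow> F (S - {u}) > 0"
        have "F S > 0" if F: "avoidance ?G S p F" for F
        proof -
          have "avoidance ?G (S - {u}) ?p (\<lambda>T. F (insert u T))"
            using psubset.prems(2)[OF w(1)] leaf w
            by (intro avoidance_leaf[OF F u w(1) \<open>u \<noteq> w\<close> 3(2)[OF u] _ sym_base_graph]) auto
          from pos[rule_format, OF this] show ?thesis using u by (simp add: insert_absorb)
        qed
        then show ?thesis by blast
      qed
    qed
  qed
qed

section \<open>Avoiding events with a given dependency graph\<close>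

text \<open>Avoiding non-neighbors of \<open>i\<close> is an event of the sigma-algebra they
  generate, so independence gives the first inequality, even with equality. Supermodularity holds
  because inserting \<open>k\<close> costs the measure of \<open>A k \<inter> C T\<close>, which
  decreases as \<open>T\<close> grows.\<close>

lemma avoidance_dependency_graph:
  assumes "prob_space M" and A: "\<And>i. i \<in> {1..n} \<Longrightarrow> A i \<in> sets M"
    and p: "\<And>i. i \<in> {1..n} \<Longrightarrow> measure M (A i) = p i"
    and dep: "dependency_graph M n G A"
  shows "avoidance G {1..n} p (\<lambda>T. measure M {x \<in> space M. \<forall>i\<in>T. x \<notin> A i})"
proof -
  interpret prob_space M by fact
  define C where "C T = {x \<in> space M. \<forall>i\<in>T. x \<notin> A i}" for T
  have C_meas: "C T \<in> sets M" if "T \<subseteq> {1..n}" for T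
  proof -
    have "finite T" using that finite_subset by blast
    then show ?thesis
      using that unfolding C_def
    proof (induction T)
      case (insert i T)
      have "{x \<in> space M. \<forall>k\<in>insert i T. x \<notin> A k} = {x \<in> space M. \<forall>k\<in>T. x \<notin> A k} - A i" by auto
      then show ?case using insert A by auto
    qed simp
  qed
  have split: "measure M (C (insert i T)) = measure M (C T) - measure M (A i \<inter> C T)"
    if "i \<in> {1..n}" "T \<subseteq> {1..n}" for i T
  proof -
    have "C (insert i T) = C T - A i \<inter> C T" by (auto simp: C_def)
    then show ?thesis using C_meas[OF that(2)] A[OF that(1)] by (simp add: finite_measure_Diff)
  qed
  have "avoidance G {1..n} p (\<lambda>T. measure M (C T))"
    unfolding avoidance_def
  proof (intro conjI ballI allI impI)
    show "measure M (C {}) > 0" by (simp add: C_def prob_space)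
  next
    fix i T assume *: "i \<in> {1..n}" "T \<subseteq> {1..n}" "i \<notin> T" "\<forall>k\<in>T. (i, k) \<notin> G"
    let ?N = "A ` {j \<in> {1..n}. j \<noteq> i \<and> (i, j) \<notin> G}"
    have T: "T \<subseteq> {j \<in> {1..n}. j \<noteq> i \<and> (i, j) \<notin> G}" using * by auto
    have "finite T" using *(2) finite_subset by blast
    then have "C T \<in> sigma_sets (space M) ?N"
      using T
    proof (induction T)
      case empty
      show ?case by (simp add: C_def sigma_sets_top)
    next
      case (insert k T)
      interpret N: sigma_algebra "space M" "sigma_sets (space M) ?N"
        by (rule sigma_algebra_sigma_sets) (use A sets.sets_into_space in blast)
      have diff: "C (insert k T) = C T - A k" by (auto simp: C_def)
      have "A k \<in> sigma_sets (space M) ?N" using insert.prems by auto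
      moreover have "C T \<in> sigma_sets (space M) ?N" using insert by blast
      ultimately show ?case unfolding diff by (rule N.Diff[rotated])
    qed
    moreover have "indep_set {A i} (sigma_sets (space M) ?N)"
      using dep *(1) by (auto simp: dependency_graph_def)
    ultimately have "measure M (A i \<inter> C T) = p i * measure M (C T)"
      using p[OF *(1)] indep_setD[of "{A i}" "sigma_sets (space M) ?N" "A i" "C T"] by auto
    then show "(1 - p i) * measure M (C T) \<le> measure M (C (insert i T))"
      using split[OF *(1,2)] by (simp add: algebra_simps)
  next
    fix i k T assume *: "i \<in> {1..n}" "k \<in> {1..n}" "T \<subseteq> {1..n}"
    have "measure M (A k \<inter> C (insert i T)) \<le> measure M (A k \<inter> C T)"
      using C_meas[OF *(3)] A[OF *(2)] by (intro finite_measure_mono) (auto simp: C_def)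
    then show "measure M (C (insert i T)) - measure M (C (insert k (insert i T)))
        \<le> measure M (C T) - measure M (C (insert k T))"
      using split[of k "insert i T"] split[of k T] * by simp
  qed
  then show ?thesis by (simp add: C_def)
qed

section \<open>Covering the cube by boxes\<close>

lemma prob_space_unit_interval: "prob_space unit_interval"
  unfolding unit_interval_def by (rule prob_spaceI) (simp add: emeasure_restrict_space)

lemma space_unit_interval: "space unit_interval = {0..1}"
  by (simp add: unit_interval_def space_restrict_space)

lemma Icc_in_sets_unit_interval:
  assumes "0 \<le> a" "b \<le> 1"
  shows "{a..b} \<in> sets unit_interval"
  using assms by (auto simp: unit_interval_def sets_restrict_space_iff)

lemma emeasure_unit_interval_Icc:
  assumes "0 \<le> a" "a \<le> b" "b \<le> 1"
  shows "emeasure unit_interval {a..b} = ennreal (b - a)"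
  using assms by (auto simp: unit_interval_def emeasure_restrict_space)

lemma space_unit_cube: "space (unit_cube I) = (\<Pi>\<^sub>E j\<in>I. {0..1})"
  by (simp add: unit_cube_def space_PiM space_unit_interval)

lemma box_in_sets_unit_cube:
  assumes "finite J" "\<And>j. j \<in> J \<Longrightarrow> 0 \<le> a j \<and> b j \<le> 1"
  shows "(\<Pi>\<^sub>E j\<in>J. {a j..b j}) \<in> sets (unit_cube J)"
  unfolding unit_cube_def using assms
  by (intro sets_completionI_sets sets_PiM_I_finite Icc_in_sets_unit_interval) auto

lemma measure_unit_cube_box:
  assumes "finite I" "J \<subseteq> I" "\<And>j. j \<in> J \<Longrightarrow> 0 \<le> a j \<and> a j \<le> b j \<and> b j \<le> 1"
  shows "measure (unit_cube I) (prod_emb I (\<lambda>_. unit_interval) J (\<Pi>\<^sub>E j\<in>J. {a j..b j}))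
    = (\<Prod>j\<in>J. b j - a j)"
proof -
  interpret product_prob_space "\<lambda>_. unit_interval" I
    by (rule product_prob_spaceI) (rule prob_space_unit_interval)
  have J: "finite J" using assms finite_subset by blast
  have meas: "{a j..b j} \<in> sets unit_interval" if "j \<in> J" for j
    using assms(3)[OF that] by (intro Icc_in_sets_unit_interval) auto
  let ?B = "prod_emb I (\<lambda>_. unit_interval) J (\<Pi>\<^sub>E j\<in>J. {a j..b j})"
  have "?B \<in> sets (PiM I (\<lambda>_. unit_interval))"
    using J assms(2) meas by (intro sets_PiM_I) auto
  moreover have "emeasure (PiM I (\<lambda>_. unit_interval)) ?B = (\<Prod>j\<in>J. ennreal (b j - a j))"
    using J assms meas
    by (subst emeasure_PiM_emb) (auto intro!: prod.cong simp: emeasure_unit_interval_Icc)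
  ultimately show ?thesis
    using assms(3) unfolding unit_cube_def
    by (simp add: measure_def prod_ennreal prod_nonneg)
qed

text \<open>Each factor moves from 1 at \<open>t = 0\<close> to \<open>l j\<close> at
  \<open>t = 1\<close>, so the intermediate value theorem applies. This serves to enlarge a box to a
  prescribed volume.\<close>

lemma prod_eq_by_scaling:
  fixes l :: "'a \<Rightarrow> real"
  assumes "(\<Prod>j\<in>J. l j) \<le> c" "c \<le> 1"
  obtains t where "0 \<le> t" "t \<le> 1" "(\<Prod>j\<in>J. 1 - t * (1 - l j)) = c"
proof -
  have "\<exists>t\<ge>0. t \<le> 1 \<and> (\<Prod>j\<in>J. 1 - t * (1 - l j)) = c"
    using assms by (intro IVT2') (auto intro!: continuous_intros)
  then show thesis using that by blast
qed

text \<open>The interior prescribes exact measures, while the cover only bounds volumes from above.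
  Enlarging every box to volume \<open>p i\<close> keeps the cube covered and leaves an empty
  complement.\<close>

lemma box_cover_not_interior:
  assumes "bigraph n m E" and B: "box_cover E {1..n} p R a b"
    and nonempty: "\<And>i. i \<in> {1..n} - R \<Longrightarrow> nbrs E i \<noteq> {}"
    and p: "\<And>i. i \<in> {1..n} \<Longrightarrow> 0 \<le> p i \<and> p i \<le> 1"
  shows "p \<notin> bigraph_interior n m E"
proof
  assume interior: "p \<in> bigraph_interior n m E"
  have nbrs: "nbrs E i \<subseteq> {1..m}" for i
    using assms(1) by (auto simp: bigraph_def nbrs_def)
  then have fin: "finite (nbrs E i)" for i
    using finite_subset by blast
  \<comment> \<open>Vertices outside \<open>R\<close> start from the degenerate box at 0. Its volume
    is 0 only if there is some coordinate, as an empty product is 1; hence the assumption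
    \<open>nonempty\<close>.\<close>
  define a' where "a' i j = (if i \<in> R then a i j else 0)" for i j
  define b' where "b' i j = (if i \<in> R then b i j else 0)" for i j
  have bounds: "0 \<le> a' i j" "a' i j \<le> b' i j" "b' i j \<le> 1" for i j
    using B by (auto simp: a'_def b'_def box_cover_def)
  have "\<exists>t. 0 \<le> t \<and> t \<le> 1 \<and> (\<Prod>j\<in>nbrs E i. 1 - t * (1 - (b' i j - a' i j))) = p i"
    if i: "i \<in> {1..n}" for i
  proof -
    have "(\<Prod>j\<in>nbrs E i. b' i j - a' i j) \<le> p i"
    proof (cases "i \<in> R")
      case True
      then show ?thesis using B by (auto simp: a'_def b'_def box_cover_def)
    next
      case False
      then have "(\<Prod>j\<in>nbrs E i. b' i j - a' i j) = 0"
        using nonempty i fin by (auto simp: a'_def b'_def power_0_left)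
      then show ?thesis using p i by simp
    qed
    then show ?thesis using prod_eq_by_scaling p i by metis
  qed
  then obtain t where t: "\<And>i. i \<in> {1..n} \<Longrightarrow> 0 \<le> t i \<and> t i \<le> 1"
    and prod: "\<And>i. i \<in> {1..n} \<Longrightarrow> (\<Prod>j\<in>nbrs E i. 1 - t i * (1 - (b' i j - a' i j))) = p i"
    by metis
  \<comment> \<open>Both endpoints are interpolated between the full side at \<open>t i = 0\<close>
    and the given side at \<open>t i = 1\<close>, so the length is the factor in
    \<open>prod\<close>.\<close>
  define lo where "lo i j = t i * a' i j" for i j
  define hi where "hi i j = 1 - t i * (1 - b' i j)" for i j
  have range: "0 \<le> lo i j" "lo i j \<le> hi i j" "hi i j \<le> 1" "lo i j \<le> a' i j" "b' i j \<le> hi i j"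
    if "i \<in> {1..n}" for i j
  proof -
    have ti: "0 \<le> t i" "t i \<le> 1" using t[OF that] by auto
    show "0 \<le> lo i j" using ti bounds[of i j] by (simp add: lo_def)
    show lo: "lo i j \<le> a' i j"
      using ti bounds[of i j] by (simp add: lo_def mult_left_le_one_le)
    have "t i * (1 - b' i j) \<le> 1 - b' i j"
      using ti bounds[of i j] by (intro mult_left_le_one_le) auto
    then show hi: "b' i j \<le> hi i j" by (simp add: hi_def)
    show "hi i j \<le> 1" using ti bounds[of i j] by (simp add: hi_def)
    show "lo i j \<le> hi i j" using lo hi bounds[of i j] by linarith
  qed
  define A where
    "A i = prod_emb {1..m} (\<lambda>_. unit_interval) (nbrs E i) (\<Pi>\<^sub>E j\<in>nbrs E i. {lo i j..hi i j})" for i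
  have "conforms n m E A"
    unfolding conforms_def A_def using range fin by (auto intro!: bexI box_in_sets_unit_cube)
  moreover have "measure (unit_cube {1..m}) (A i) = p i" if i: "i \<in> {1..n}" for i
  proof -
    have "measure (unit_cube {1..m}) (A i) = (\<Prod>j\<in>nbrs E i. hi i j - lo i j)"
      unfolding A_def using range[OF i] nbrs by (intro measure_unit_cube_box) auto
    also have "\<dots> = p i"
      unfolding prod[OF i, symmetric] by (intro prod.cong) (auto simp: hi_def lo_def algebra_simps)
    finally show ?thesis .
  qed
  ultimately have pos: "measure (unit_cube {1..m})
      {x \<in> space (unit_cube {1..m}). \<forall>i\<in>{1..n}. x \<notin> A i} > 0"
    using interior by (simp add: bigraph_interior_def)
  have cover: "\<exists>i\<in>R. \<forall>j\<in>nbrs E i. a i j \<le> x j \<and> x j \<le> b i j"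
    if "\<forall>j. 0 \<le> x j \<and> x j \<le> 1" for x
    using B that by (simp add: box_cover_def)
  have "\<exists>i\<in>{1..n}. x \<in> A i" if x: "x \<in> space (unit_cube {1..m})" for x
  proof -
    \<comment> \<open>Covers speak of total functions into the unit interval, whereas points of the
      cube are \<open>undefined\<close> outside \<open>{1..m}\<close>; 0 is a filler value.\<close>
    let ?x = "\<lambda>j. if j \<in> {1..m} then x j else 0"
    have x01: "x j \<in> {0..1}" if "j \<in> {1..m}" for j
      using x that by (auto simp: space_unit_cube PiE_iff)
    then have "\<forall>j. 0 \<le> ?x j \<and> ?x j \<le> 1" by auto
    then have "\<exists>i\<in>R. \<forall>j\<in>nbrs E i. a i j \<le> ?x j \<and> ?x j \<le> b i j"
      by (rule cover)
    then obtain i where i: "i \<in> R" "\<forall>j\<in>nbrs E i. a i j \<le> ?x j \<and> ?x j \<le> b i j" ..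
    have "i \<in> {1..n}" using B i by (auto simp: box_cover_def)
    have "x j \<in> {lo i j..hi i j}" if j: "j \<in> nbrs E i" for j
    proof -
      have "j \<in> {1..m}" using nbrs j by blast
      then have "a' i j \<le> x j \<and> x j \<le> b' i j" using i j by (auto simp: a'_def b'_def)
      then show ?thesis using range[OF \<open>i \<in> {1..n}\<close>, of j] by auto
    qed
    then have "x \<in> A i"
      using x unfolding A_def prod_emb_def
      by (auto simp: space_unit_cube space_unit_interval PiE_iff)
    then show ?thesis using \<open>i \<in> {1..n}\<close> by blast
  qed
  then have empty: "{x \<in> space (unit_cube {1..m}). \<forall>i\<in>{1..n}. x \<notin> A i} = {}" by blast
  show False using pos unfolding empty by simp
qed

section \<open>Treelike bigraphs\<close>

text \<open>A path from \<open>i\<close> to another vertex begins with an edge, hence with a shared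
  variable. The second vertex matters: a single vertex may have no variables.\<close>

lemma treelike_nbrs_nonempty:
  assumes "treelike n E" "i \<in> {1..n}" "k \<in> {1..n}" "i \<noteq> k"
  shows "nbrs E i \<noteq> {}"
proof -
  have "(i, k) \<in> (base_graph n E)\<^sup>*"
    using assms by (auto simp: treelike_def is_tree_def)
  then obtain j where "(i, j) \<in> base_graph n E"
    using \<open>i \<noteq> k\<close> by (meson converse_rtranclE)
  then show ?thesis by (auto simp: base_graph_def)
qed

lemma treelike_interior_subset:
  assumes "bigraph n m E" "treelike n E"
  shows "bigraph_interior n m E \<subseteq> abstract_interior W n (base_graph n E)"
proof
  fix p assume p: "p \<in> bigraph_interior n m E"
  then have p01: "p \<in> {1..n} \<rightarrow>\<^sub>E {0<..<1}" by (simp add: bigraph_interior_def)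
  then have p_pos: "0 < p i" "p i < 1" if "i \<in> {1..n}" for i
    using PiE_mem[OF p01 that] by auto
  have no_cover: "\<not> box_cover E {1..n} p R a b" for R a b
  proof
    assume B: "box_cover E {1..n} p R a b"
    \<comment> \<open>The origin lies in some box, so \<open>R\<close> has an element
      \<open>r\<close>; every vertex outside \<open>R\<close> differs from \<open>r\<close> and so
      has a variable.\<close>
    have "\<exists>r\<in>R. \<forall>j\<in>nbrs E r. a r j \<le> 0 \<and> 0 \<le> b r j"
      using B by (simp add: box_cover_def)
    then obtain r where "r \<in> R" by blast
    moreover have "R \<subseteq> {1..n}" using B by (simp add: box_cover_def)
    ultimately have "nbrs E i \<noteq> {}" if "i \<in> {1..n} - R" for i
      using treelike_nbrs_nonempty[OF assms(2), of i r] that by blast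
    then show False
      using box_cover_not_interior[OF assms(1) B] p p_pos by (meson less_imp_le)
  qed
  have "\<nexists>xs. is_cycle (base_graph n E) xs"
    using assms(2) by (simp add: treelike_def is_tree_def)
  from box_cover_or_avoidance_pos[OF assms(1) this, of "{1..n}" p]
  have pos: "F {1..n} > 0" if "avoidance (base_graph n E) {1..n} p F" for F
    using no_cover p_pos that by blast
  show "p \<in> abstract_interior W n (base_graph n E)"
    unfolding abstract_interior_def
    using p01 avoidance_dependency_graph pos by blast
qed

theorem theorem6:
  fixes n m :: nat and E :: "(nat \<times> nat) set"
  assumes "bigraph n m E"
    and "treelike n E"
  shows "gapless TYPE('w) n m E"
  using treelike_interior_subset[OF assms, of "TYPE('w)"]
  unfolding gapless_def gapful_def gapful_in_direction_def by blast

end
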